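(* There is an inclusion of mould subspaces $ARI_{\underline{al}/\underline{al}}\subset ARI_{al+push/circneut}$. Moreover, for $r\in\{1,2,3\}$, $ARI^r\cap ARI_{\underline{al}/\underline{al}}=ARI^r\cap ARI_{al+push/circneut}$.
   Context: $ARI$ is the space of moulds $A=(A^r)_{r\ge0}$ with $A^r\in\mathbb{Q}(u_1,\dots,u_r)$ and $A^0=0$; $\overline{ARI}$ is the same with variables $v_1,v_2,\dots$. $ARI^r$ is the subspace of moulds concentrated in depth $r$ (i.e. $A^s=0$ for $s\ne r$). $swap:ARI\to\overline{ARI}$ is $swap(A)(v_1,\dots,v_r)=A(v_r,v_{r-1}-v_r,\dots,v_1-v_2)$. A mould is alternal if for every $r\ge2$ and $1\le i\le[r/2]$, $\sum_{w}A^r(w)=0$, the sum over all shuffles $w$ of $(u_1,\dots,u_i)$ and $(u_{i+1},\dots,u_r)$ (no condition in depth 1); the same definition applies in $\overline{ARI}$. $A$ is push-invariant if $A(u_0,u_1,\dots,u_{r-1})=A(u_1,\dots,u_r)$ for all $r$, $u_0=-u_1-\dots-u_r$. $B\in\overline{ARI}$ is circ-neutral if $\sum_{i=0}^{r-1}B(v_{i+1},\dots,v_r,v_1,\dots,v_i)=0$ for all $r>1$. $ARI_{\underline{al}/\underline{al}}$ is the space of alternal $A\in ARI$ with alternal swap and with $A^1(-u_1)=A^1(u_1)$. $ARI_{al+push/circneut}$ is the space of alternal, push-invariant $A\in ARI$ whose swap is circ-neutral. *)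

theory Defs
  imports Complex_Main "HOL-Library.Poly_Mapping" "HOL-Computational_Algebra.Fraction_Field"
begin

text \<open>Polynomials over Q in the variables u_1, u_2, ... (variable u_i has index i),
  and the field Q(u_1, u_2, ...) of rational functions as their fraction field.\<close>

type_synonym mpoly = "(nat \<Rightarrow>\<^sub>0 nat) \<Rightarrow>\<^sub>0 rat"
type_synonym ratfun = "mpoly fract"

definition var_poly :: "nat \<Rightarrow> mpoly" where
  "var_poly i = Poly_Mapping.single (Poly_Mapping.single i 1) 1"

definition var :: "nat \<Rightarrow> ratfun" where
  "var i = Fract (var_poly i) 1"

definition const :: "rat \<Rightarrow> ratfun" where
  "const c = Fract (Poly_Mapping.single 0 c) 1"

definition poly_vars :: "mpoly \<Rightarrow> nat set" where
  "poly_vars p = (\<Union>m\<in>Poly_Mapping.keys p. Poly_Mapping.keys (m :: nat \<Rightarrow>\<^sub>0 nat))"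

definition peval :: "(nat \<Rightarrow> ratfun) \<Rightarrow> mpoly \<Rightarrow> ratfun" where
  "peval \<sigma> p = (\<Sum>m\<in>Poly_Mapping.keys p. const (Poly_Mapping.lookup p m) * (\<Prod>i\<in>Poly_Mapping.keys (m :: nat \<Rightarrow>\<^sub>0 nat). \<sigma> i ^ Poly_Mapping.lookup m i))"

text \<open>Substitution of rational functions for the variables in a rational function
  (well defined for the invertible linear substitutions used below).\<close>
definition subst :: "(nat \<Rightarrow> ratfun) \<Rightarrow> ratfun \<Rightarrow> ratfun" where
  "subst \<sigma> f = (SOME g. \<exists>n d. d \<noteq> 0 \<and> f = Fract n d \<and> g = peval \<sigma> n / peval \<sigma> d)"

definition in_Qr :: "nat \<Rightarrow> ratfun \<Rightarrow> bool" where
  "in_Qr r f \<longleftrightarrow> (\<exists>n d. d \<noteq> 0 \<and> f = Fract n d \<and> poly_vars n \<subseteq> {1..r} \<and> poly_vars d \<subseteq> {1..r})"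

text \<open>A mould is a sequence A = (A^r) with A^r in Q(u_1,...,u_r) and A^0 = 0.
  The same type serves for ARI (variables u_i) and ARI-bar (variables v_i).\<close>
type_synonym mould = "nat \<Rightarrow> ratfun"

definition is_mould :: "mould \<Rightarrow> bool" where
  "is_mould A \<longleftrightarrow> A 0 = 0 \<and> (\<forall>r. in_Qr r (A r))"

definition mev :: "mould \<Rightarrow> ratfun list \<Rightarrow> ratfun" where
  "mev A ws = subst (\<lambda>i. if 1 \<le> i \<and> i \<le> length ws then ws ! (i - 1) else var i) (A (length ws))"

definition swap :: "mould \<Rightarrow> mould" where
  "swap A r = mev A (map (\<lambda>k. if k = 0 then var r else var (r - k) - var (r - k + 1)) [0..<r])"

definition alternal :: "mould \<Rightarrow> bool" where
  "alternal A \<longleftrightarrow> (\<forall>r\<ge>2. \<forall>i. 1 \<le> i \<and> i \<le> r div 2 \<longrightarrow>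
      (\<Sum>w\<in>shuffles (map var [1..<i+1]) (map var [i+1..<r+1]). mev A w) = 0)"

definition push_invariant :: "mould \<Rightarrow> bool" where
  "push_invariant A \<longleftrightarrow> (\<forall>r\<ge>1.
      mev A ((- (\<Sum>i=1..r. var i)) # map var [1..<r]) = mev A (map var [1..<r+1]))"

definition circ_neutral :: "mould \<Rightarrow> bool" where
  "circ_neutral B \<longleftrightarrow> (\<forall>r>1. (\<Sum>i<r. mev B (rotate i (map var [1..<r+1]))) = 0)"

definition ARI_depth :: "nat \<Rightarrow> mould set" where
  "ARI_depth r = {A. is_mould A \<and> (\<forall>s. s \<noteq> r \<longrightarrow> A s = 0)}"

definition ARI_al_al :: "mould set" where
  "ARI_al_al = {A. is_mould A \<and> alternal A \<and> alternal (swap A) \<and> mev A [- var 1] = mev A [var 1]}"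

definition ARI_al_push_circneut :: "mould set" where
  "ARI_al_push_circneut = {A. is_mould A \<and> alternal A \<and> push_invariant A \<and> circ_neutral (swap A)}"

end

theory Submission
  imports Defs
begin

text \<open>
  In depth r, introduce cyclic coordinates \<open>x\<^sub>0, \<dots>, x\<^sub>r\<close> whose consecutive differences are the
  \<open>u\<^sub>i\<close>, and view \<open>A\<^sup>r\<close> as a translation invariant function \<open>G\<close> of the cyclic word.
  Setting the last letter to zero gives the swap, and push is the rotation of the word.
  Alternality of \<open>A\<close> gives \<open>G(x) = (-1)\<^sup>r\<^sup>-\<^sup>1 G(- rev x)\<close>, and alternality of the swap allows one to
  reverse all letters but one, with the same sign; together, rotating the word amounts to negating the
  variables. Hence the odd part of \<open>G\<close> changes sign under rotation. For even r it
  vanishes because r + 1 rotations are the identity; for odd r > 1 the relation obtained by inserting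
  one letter into the cyclic word becomes an alternating sum over rotations of a word of odd
  length r, and adding it to its rotate leaves twice a single value. So \<open>G\<close> is even and rotation invariant.
  For a rotation invariant \<open>G\<close>, inserting a letter in all gaps is the same as
  cutting in all places, so circ-neutrality is the first alternality relation of the swap; for
  \<open>r \<le> 3\<close> there is no other.
\<close>

section \<open>Evaluation and substitution\<close>

lemma const_0 [simp]: "const 0 = 0"
  and const_1 [simp]: "const 1 = 1"
  and const_add: "const (a + b) = const a + const b"
  and const_mult: "const (a * b) = const a * const b"
  by (simp_all add: const_def Zero_fract_def One_fract_def single_add mult_single)

lemma Fract_eq_0_iff: "d \<noteq> 0 \<Longrightarrow> Fract n d = 0 \<longleftrightarrow> n = (0 :: mpoly)"
  by (simp add: Zero_fract_def eq_fract)

lemma var_eq_iff [simp]: "var i = var j \<longleftrightarrow> i = j"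
proof
  assume "var i = var j"
  then have "var_poly i = var_poly j"
    by (simp add: var_def eq_fract)
  then have "Poly_Mapping.keys (var_poly i) = Poly_Mapping.keys (var_poly j)"
    by simp
  then have "Poly_Mapping.single i (1 :: nat) = Poly_Mapping.single j 1"
    by (simp add: var_poly_def)
  then have "Poly_Mapping.keys (Poly_Mapping.single i (1 :: nat)) = Poly_Mapping.keys (Poly_Mapping.single j (1 :: nat))"
    by simp
  then show "i = j"
    by simp
qed simp

section \<open>Evaluation of polynomials as a ring homomorphism\<close>

definition monom_eval :: "(nat \<Rightarrow> ratfun) \<Rightarrow> (nat \<Rightarrow>\<^sub>0 nat) \<Rightarrow> ratfun" where
  "monom_eval \<sigma> m = (\<Prod>i\<in>Poly_Mapping.keys m. \<sigma> i ^ Poly_Mapping.lookup m i)"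

lemma monom_eval_superset:
  assumes "finite I" "Poly_Mapping.keys m \<subseteq> I"
  shows "monom_eval \<sigma> m = (\<Prod>i\<in>I. \<sigma> i ^ Poly_Mapping.lookup m i)"
  unfolding monom_eval_def using assms
  by (intro prod.mono_neutral_left) (auto simp: in_keys_iff)

lemma monom_eval_add: "monom_eval \<sigma> (m + n) = monom_eval \<sigma> m * monom_eval \<sigma> n"
proof -
  let ?I = "Poly_Mapping.keys m \<union> Poly_Mapping.keys n"
  have "monom_eval \<sigma> k = (\<Prod>i\<in>?I. \<sigma> i ^ Poly_Mapping.lookup k i)" if "k \<in> {m, n, m + n}" for k
    using that keys_add[of m n] by (intro monom_eval_superset) auto
  then show ?thesis
    by (simp add: lookup_add power_add prod.distrib)
qed

lemma peval_superset:
  assumes "finite M" "Poly_Mapping.keys p \<subseteq> M"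
  shows "peval \<sigma> p = (\<Sum>m\<in>M. const (Poly_Mapping.lookup p m) * monom_eval \<sigma> m)"
  unfolding peval_def monom_eval_def[symmetric] using assms
  by (intro sum.mono_neutral_left) (auto simp: in_keys_iff)

lemma peval_0 [simp]: "peval \<sigma> 0 = 0"
  by (simp add: peval_def)

lemma peval_add: "peval \<sigma> (p + q) = peval \<sigma> p + peval \<sigma> q"
proof -
  let ?M = "Poly_Mapping.keys p \<union> Poly_Mapping.keys q"
  have "peval \<sigma> k = (\<Sum>m\<in>?M. const (Poly_Mapping.lookup k m) * monom_eval \<sigma> m)"
    if "k \<in> {p, q, p + q}" for k
    using that keys_add[of p q] by (intro peval_superset) auto
  then show ?thesis
    by (simp add: lookup_add const_add distrib_right sum.distrib)
qed

lemma peval_sum: "peval \<sigma> (\<Sum>x\<in>X. f x) = (\<Sum>x\<in>X. peval \<sigma> (f x))"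
  by (induction X rule: infinite_finite_induct) (simp_all add: peval_add)

lemma peval_single: "peval \<sigma> (Poly_Mapping.single m c) = const c * monom_eval \<sigma> m"
  by (cases "c = 0") (simp_all add: peval_def monom_eval_def)

lemma peval_single_0 [simp]: "peval \<sigma> (Poly_Mapping.single 0 c) = const c"
  by (simp add: peval_single monom_eval_def)

lemma peval_var_poly [simp]: "peval \<sigma> (var_poly i) = \<sigma> i"
  by (simp add: var_poly_def peval_single monom_eval_def)

lemma mpoly_eq_sum_single:
  "(\<Sum>m\<in>Poly_Mapping.keys p. Poly_Mapping.single m (Poly_Mapping.lookup p m)) = p"
  by (rule poly_mapping_eqI)
    (auto simp: lookup_sum lookup_single when_def in_keys_iff sum.delta)

lemma peval_mult: "peval \<sigma> (p * q) = peval \<sigma> p * peval \<sigma> q"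
proof -
  have "peval \<sigma> (p * q) = peval \<sigma> ((\<Sum>m\<in>Poly_Mapping.keys p. Poly_Mapping.single m (Poly_Mapping.lookup p m)) *
      (\<Sum>n\<in>Poly_Mapping.keys q. Poly_Mapping.single n (Poly_Mapping.lookup q n)))"
    by (simp add: mpoly_eq_sum_single)
  also have "\<dots> = (\<Sum>m\<in>Poly_Mapping.keys p. \<Sum>n\<in>Poly_Mapping.keys q.
      (const (Poly_Mapping.lookup p m) * monom_eval \<sigma> m) * (const (Poly_Mapping.lookup q n) * monom_eval \<sigma> n))"
    by (simp add: sum_product peval_sum mult_single peval_single monom_eval_add const_mult mult_ac)
  also have "\<dots> = peval \<sigma> p * peval \<sigma> q"
    by (simp add: peval_def monom_eval_def sum_product)
  finally show ?thesis .
qed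

lemma peval_1 [simp]: "peval \<sigma> 1 = 1"
  using peval_single_0[of \<sigma> 1] by simp

lemma peval_minus: "peval \<sigma> (- p) = - peval \<sigma> p"
proof -
  have "peval \<sigma> (- p) + peval \<sigma> p = 0"
    by (simp flip: peval_add)
  then show ?thesis
    by (simp add: eq_neg_iff_add_eq_0)
qed

lemma peval_cong:
  assumes "\<And>i. i \<in> poly_vars p \<Longrightarrow> \<sigma> i = \<tau> i"
  shows "peval \<sigma> p = peval \<tau> p"
  unfolding peval_def
  by (intro sum.cong prod.cong arg_cong2[where f = "(*)"] arg_cong2[where f = "(^)"] refl assms)
    (auto simp: poly_vars_def)

text \<open>Universal property of the polynomial ring: sums and products reduce
  \<open>\<phi>\<close> to single variables. It identifies composite maps as evaluations.\<close>

lemma peval_unique: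
  assumes add: "\<And>p q. \<phi> (p + q) = \<phi> p + \<phi> q"
    and mult: "\<And>p q. \<phi> (p * q) = \<phi> p * \<phi> q"
    and const: "\<And>c. \<phi> (Poly_Mapping.single 0 c) = const c"
  shows "\<phi> p = peval (\<lambda>i. \<phi> (var_poly i)) p"
proof -
  have zero: "\<phi> 0 = 0" and one: "\<phi> 1 = 1"
    using const[of 0] const[of 1] by simp_all
  have sum: "\<phi> (\<Sum>x\<in>X. f x) = (\<Sum>x\<in>X. \<phi> (f x))" for f and X :: "(nat \<Rightarrow>\<^sub>0 nat) set"
    by (induction X rule: infinite_finite_induct) (simp_all add: add zero)
  have power: "\<phi> (Poly_Mapping.single (Poly_Mapping.single i n) 1) = \<phi> (var_poly i) ^ n" for i n
  proof (induction n)
    case (Suc n)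
    have "Poly_Mapping.single (Poly_Mapping.single i (Suc n)) (1 :: rat) =
        var_poly i * Poly_Mapping.single (Poly_Mapping.single i n) 1"
      by (simp add: var_poly_def mult_single flip: single_add)
    then show ?case
      by (simp add: mult Suc)
  qed (simp add: one)
  have prod: "\<phi> (Poly_Mapping.single (\<Sum>i\<in>I. Poly_Mapping.single i (f i)) 1) =
      (\<Prod>i\<in>I. \<phi> (var_poly i) ^ f i)" if "finite I" for I and f :: "nat \<Rightarrow> nat"
    using that
  proof (induction I)
    case (insert i I)
    have "Poly_Mapping.single (\<Sum>i\<in>insert i I. Poly_Mapping.single i (f i)) (1 :: rat) =
        Poly_Mapping.single (Poly_Mapping.single i (f i)) 1 *
        Poly_Mapping.single (\<Sum>i\<in>I. Poly_Mapping.single i (f i)) 1"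
      using insert by (simp add: mult_single)
    then show ?case
      using insert by (simp add: mult power)
  qed (simp add: one)
  have "(\<Sum>i\<in>Poly_Mapping.keys m. Poly_Mapping.single i (Poly_Mapping.lookup m i)) = m" for m :: "nat \<Rightarrow>\<^sub>0 nat"
    by (rule poly_mapping_eqI)
      (auto simp: lookup_sum lookup_single when_def in_keys_iff sum.delta)
  then have "\<phi> (Poly_Mapping.single m 1) = monom_eval (\<lambda>i. \<phi> (var_poly i)) m" for m
    using prod[of "Poly_Mapping.keys m" "Poly_Mapping.lookup m"] by (simp add: monom_eval_def)
  then have "\<phi> (Poly_Mapping.single m c) = const c * monom_eval (\<lambda>i. \<phi> (var_poly i)) m" for m c
    using mult[of "Poly_Mapping.single 0 c" "Poly_Mapping.single m 1"] const by (simp add: mult_single)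
  then have "\<phi> (\<Sum>m\<in>Poly_Mapping.keys p. Poly_Mapping.single m (Poly_Mapping.lookup p m)) =
      peval (\<lambda>i. \<phi> (var_poly i)) p"
    by (simp add: sum peval_def monom_eval_def)
  then show ?thesis
    by (simp add: mpoly_eq_sum_single)
qed

lemma peval_var: "peval var p = Fract p 1"
  using peval_unique[of "\<lambda>p. Fract p 1" p] by (simp add: const_def var_def[abs_def])

text \<open>The operator \<^const>\<open>subst\<close> picks an arbitrary representation of a fraction, whose denominator
  may evaluate to zero. It is well behaved for the substitutions below.\<close>

definition nondegenerate :: "(nat \<Rightarrow> ratfun) \<Rightarrow> bool" where
  "nondegenerate \<sigma> \<longleftrightarrow> (\<forall>p. peval \<sigma> p = 0 \<longrightarrow> p = 0)"

lemma peval_eq_0_iff: "nondegenerate \<sigma> \<Longrightarrow> peval \<sigma> p = 0 \<longleftrightarrow> p = 0"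
  by (auto simp: nondegenerate_def)

text \<open>Evaluate \<open>n * d' = n' * d\<close> and divide by the nonzero values of both
  denominators: the representation chosen does not matter.\<close>

lemma subst_Fract:
  assumes "nondegenerate \<sigma>" "d \<noteq> 0"
  shows "subst \<sigma> (Fract n d) = peval \<sigma> n / peval \<sigma> d"
  unfolding subst_def
proof (rule some_equality)
  show "\<exists>n' d'. d' \<noteq> 0 \<and> Fract n d = Fract n' d' \<and> peval \<sigma> n / peval \<sigma> d = peval \<sigma> n' / peval \<sigma> d'"
    using assms by blast
next
  fix g
  assume "\<exists>n' d'. d' \<noteq> 0 \<and> Fract n d = Fract n' d' \<and> g = peval \<sigma> n' / peval \<sigma> d'"
  then obtain n' d' where *: "d' \<noteq> 0" "Fract n d = Fract n' d'" "g = peval \<sigma> n' / peval \<sigma> d'"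
    by blast
  then have "n * d' = n' * d"
    using assms by (simp add: eq_fract)
  then have "peval \<sigma> n * peval \<sigma> d' = peval \<sigma> n' * peval \<sigma> d"
    by (simp flip: peval_mult)
  then show "g = peval \<sigma> n / peval \<sigma> d"
    using * assms by (simp add: peval_eq_0_iff frac_eq_eq)
qed

lemma subst_Fract_1: "nondegenerate \<sigma> \<Longrightarrow> subst \<sigma> (Fract p 1) = peval \<sigma> p"
  by (simp add: subst_Fract)

lemma subst_var [simp]: "nondegenerate \<sigma> \<Longrightarrow> subst \<sigma> (var i) = \<sigma> i"
  by (simp add: var_def subst_Fract_1)

lemma subst_add:
  assumes "nondegenerate \<sigma>"
  shows "subst \<sigma> (f + g) = subst \<sigma> f + subst \<sigma> g"
  using assms
  by (cases f, cases g) (simp add: subst_Fract peval_add peval_mult peval_eq_0_iff add_frac_eq)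

lemma subst_mult:
  assumes "nondegenerate \<sigma>"
  shows "subst \<sigma> (f * g) = subst \<sigma> f * subst \<sigma> g"
  using assms by (cases f, cases g) (simp add: subst_Fract peval_mult)

lemma subst_0 [simp]: "subst \<sigma> 0 = 0"
proof -
  have "\<exists>g n d. d \<noteq> 0 \<and> (0 :: ratfun) = Fract n d \<and> g = peval \<sigma> n / peval \<sigma> d"
    by (intro exI[of _ "peval \<sigma> 0 / peval \<sigma> 1"] exI[of _ 0] exI[of _ 1]) (simp add: Zero_fract_def)
  then have "\<exists>n d. d \<noteq> 0 \<and> (0 :: ratfun) = Fract n d \<and> subst \<sigma> 0 = peval \<sigma> n / peval \<sigma> d"
    unfolding subst_def by (rule someI_ex)
  \<comment> \<open>Any representation of 0 has numerator 0, and 0 divided by any value, even 0, is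
    0.\<close>
  then show ?thesis
    by (metis Fract_eq_0_iff peval_0 div_0)
qed

lemma subst_minus:
  assumes "nondegenerate \<sigma>"
  shows "subst \<sigma> (- f) = - subst \<sigma> f"
  using subst_add[OF assms, of "- f" f] by (simp add: eq_neg_iff_add_eq_0)

lemma subst_diff:
  assumes "nondegenerate \<sigma>"
  shows "subst \<sigma> (f - g) = subst \<sigma> f - subst \<sigma> g"
  using subst_add[OF assms, of f "- g"] by (simp add: subst_minus assms)

lemma subst_sum:
  assumes "nondegenerate \<sigma>"
  shows "subst \<sigma> (\<Sum>x\<in>X. f x) = (\<Sum>x\<in>X. subst \<sigma> (f x))"
  by (induction X rule: infinite_finite_induct) (simp_all add: subst_add assms)

lemma subst_eq_0_iff:
  assumes "nondegenerate \<sigma>"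
  shows "subst \<sigma> f = 0 \<longleftrightarrow> f = 0"
  using assms by (cases f) (simp add: subst_Fract peval_eq_0_iff Fract_eq_0_iff)

lemma subst_eq_iff:
  assumes "nondegenerate \<sigma>"
  shows "subst \<sigma> f = subst \<sigma> g \<longleftrightarrow> f = g"
  using subst_eq_0_iff[OF assms, of "f - g"] by (simp add: subst_diff assms)

text \<open>Evaluation followed by substitution is a ring homomorphism fixing constants, so its
  values on the variables determine it.\<close>

lemma subst_peval:
  assumes "nondegenerate \<rho>"
  shows "subst \<rho> (peval \<sigma> p) = peval (\<lambda>i. subst \<rho> (\<sigma> i)) p"
proof -
  have "subst \<rho> (const c) = const c" for c
    using subst_Fract_1[OF assms, of "Poly_Mapping.single 0 c"] by (simp add: const_def)
  then show ?thesis
    using peval_unique[of "\<lambda>p. subst \<rho> (peval \<sigma> p)" p] assms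
    by (simp add: peval_add peval_mult subst_add subst_mult)
qed

lemma nondegenerate_comp:
  assumes "nondegenerate \<rho>" "nondegenerate \<sigma>"
  shows "nondegenerate (\<lambda>i. subst \<rho> (\<sigma> i))"
  unfolding nondegenerate_def
  using assms by (simp add: subst_eq_0_iff peval_eq_0_iff flip: subst_peval)

lemma subst_subst:
  assumes "nondegenerate \<rho>" "nondegenerate \<sigma>"
  shows "subst \<rho> (subst \<sigma> f) = subst (\<lambda>i. subst \<rho> (\<sigma> i)) f"
proof (cases f)
  case (Fract n d)
  have "subst \<rho> (x / y) = subst \<rho> x / subst \<rho> y" if "y \<noteq> 0" for x y
    using subst_mult[OF assms(1), of "x / y" y] that assms(1)
    by (simp add: subst_eq_0_iff field_simps)
  with Fract assms show ?thesis
    by (simp add: subst_Fract nondegenerate_comp subst_peval peval_eq_0_iff)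
qed

lemma nondegenerate_var [simp]: "nondegenerate var"
  by (simp add: nondegenerate_def peval_var Fract_eq_0_iff)

lemma subst_var_id [simp]: "subst var f = f"
  by (cases f) (simp add: subst_Fract peval_var)

lemma subst_cong_in_Qr:
  assumes "in_Qr r f" "nondegenerate \<sigma>" "nondegenerate \<tau>"
    and "\<And>i. 1 \<le> i \<Longrightarrow> i \<le> r \<Longrightarrow> \<sigma> i = \<tau> i"
  shows "subst \<sigma> f = subst \<tau> f"
proof -
  from assms(1) obtain n d where *: "d \<noteq> 0" "f = Fract n d" "poly_vars n \<subseteq> {1..r}" "poly_vars d \<subseteq> {1..r}"
    by (auto simp: in_Qr_def)
  have "peval \<sigma> n = peval \<tau> n" "peval \<sigma> d = peval \<tau> d"
    using * assms(4) by (auto intro!: peval_cong)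
  with * assms show ?thesis
    by (simp add: subst_Fract)
qed

text \<open>Polynomial substitution by \<open>\<tau>\<close>, as a relation on fractions with denominator 1, so that it makes
  sense before \<open>\<tau>\<close> is known to be nondegenerate.\<close>

definition psubst_rel :: "(nat \<Rightarrow> ratfun) \<Rightarrow> ratfun \<Rightarrow> ratfun \<Rightarrow> bool" where
  "psubst_rel \<tau> a b \<longleftrightarrow> (\<exists>q. a = Fract q 1 \<and> b = peval \<tau> q)"

lemma psubst_rel_Fract: "psubst_rel \<tau> (Fract q 1) (peval \<tau> q)"
  by (auto simp: psubst_rel_def)

lemma psubst_rel_0: "psubst_rel \<tau> 0 0"
  and psubst_rel_1: "psubst_rel \<tau> 1 1"
  and psubst_rel_const: "psubst_rel \<tau> (const c) (const c)"
  and psubst_rel_var: "psubst_rel \<tau> (var i) (\<tau> i)"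
  using psubst_rel_Fract[of \<tau> 0] psubst_rel_Fract[of \<tau> 1]
    psubst_rel_Fract[of \<tau> "Poly_Mapping.single 0 c"] psubst_rel_Fract[of \<tau> "var_poly i"]
  by (simp_all add: Zero_fract_def One_fract_def const_def var_def)

lemma psubst_rel_add:
  "psubst_rel \<tau> a b \<Longrightarrow> psubst_rel \<tau> a' b' \<Longrightarrow> psubst_rel \<tau> (a + a') (b + b')"
  unfolding psubst_rel_def by clarify (rule exI, rule conjI[OF _ peval_add[symmetric]], simp)

lemma psubst_rel_mult:
  "psubst_rel \<tau> a b \<Longrightarrow> psubst_rel \<tau> a' b' \<Longrightarrow> psubst_rel \<tau> (a * a') (b * b')"
  unfolding psubst_rel_def by clarify (rule exI, rule conjI[OF _ peval_mult[symmetric]], simp)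

lemma psubst_rel_minus: "psubst_rel \<tau> a b \<Longrightarrow> psubst_rel \<tau> (- a) (- b)"
  unfolding psubst_rel_def by clarify (rule exI, rule conjI[OF _ peval_minus[symmetric]], simp)

lemma psubst_rel_diff:
  "psubst_rel \<tau> a b \<Longrightarrow> psubst_rel \<tau> a' b' \<Longrightarrow> psubst_rel \<tau> (a - a') (b - b')"
  using psubst_rel_add[of \<tau> a b "- a'" "- b'"] by (simp add: psubst_rel_minus)

lemma psubst_rel_sum:
  "(\<And>x. x \<in> X \<Longrightarrow> psubst_rel \<tau> (f x) (g x)) \<Longrightarrow> psubst_rel \<tau> (\<Sum>x\<in>X. f x) (\<Sum>x\<in>X. g x)"
  by (induction X rule: infinite_finite_induct) (auto intro: psubst_rel_0 psubst_rel_add)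

lemma psubst_rel_prod:
  "(\<And>x. x \<in> X \<Longrightarrow> psubst_rel \<tau> (f x) (g x)) \<Longrightarrow> psubst_rel \<tau> (\<Prod>x\<in>X. f x) (\<Prod>x\<in>X. g x)"
  by (induction X rule: infinite_finite_induct) (auto intro: psubst_rel_1 psubst_rel_mult)

lemma psubst_rel_power: "psubst_rel \<tau> a b \<Longrightarrow> psubst_rel \<tau> (a ^ n) (b ^ n)"
  by (induction n) (auto intro: psubst_rel_1 psubst_rel_mult)

text \<open>Substituting \<open>\<tau>\<close> into the polynomials \<open>\<sigma> i\<close> gives
  back the variables, hence turns \<open>peval \<sigma> p\<close> back into
  \<open>p\<close>.\<close>

lemma nondegenerateI:
  assumes "\<And>i. psubst_rel \<tau> (\<sigma> i) (var i)"
  shows "nondegenerate \<sigma>"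
  unfolding nondegenerate_def
proof (intro allI impI)
  fix p assume "peval \<sigma> p = 0"
  moreover have "psubst_rel \<tau> (peval \<sigma> p) (peval var p)"
    unfolding peval_def
    by (intro psubst_rel_sum psubst_rel_mult psubst_rel_prod psubst_rel_power psubst_rel_const assms)
  ultimately obtain q where "Fract q 1 = 0" "Fract p 1 = peval \<tau> q"
    by (auto simp: psubst_rel_def peval_var)
  then show "p = 0"
    by (simp add: Fract_eq_0_iff)
qed

section \<open>Shuffles and rotations of words\<close>

lemma shuffles_map: "shuffles (map f xs) (map f ys) = map f ` shuffles xs ys"
  by (induction xs ys rule: shuffles.induct) (auto simp: image_Un image_image)

text \<open>\<open>shuffles\<close> is a set without multiplicities; distinct first letters keep the
  two halves of its recursion disjoint.\<close>

lemma sum_shuffles_Cons_Cons: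
  assumes "x \<noteq> y"
  shows "sum h (shuffles (x # xs) (y # ys)) =
    (\<Sum>w\<in>shuffles xs (y # ys). h (x # w)) + (\<Sum>w\<in>shuffles (x # xs) ys. h (y # w))"
proof -
  have "(#) x ` shuffles xs (y # ys) \<inter> (#) y ` shuffles (x # xs) ys = {}"
    using assms by auto
  then show ?thesis
    by (simp add: sum.union_disjoint sum.reindex)
qed

lemma sum_shuffles_singleton:
  assumes "x \<notin> set zs"
  shows "sum h (shuffles [x] zs) = (\<Sum>j<Suc (length zs). h (take j zs @ x # drop j zs))"
  using assms
proof (induction zs arbitrary: h)
  case (Cons z zs)
  then have "sum h (shuffles [x] (z # zs)) = h (x # z # zs) + (\<Sum>w\<in>shuffles [x] zs. h (z # w))"
    by (subst sum_shuffles_Cons_Cons) auto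
  also have "\<dots> = (\<Sum>j<Suc (length (z # zs)). h (take j (z # zs) @ x # drop j (z # zs)))"
    using Cons by (subst sum.lessThan_Suc_shift) (simp del: sum.lessThan_Suc)
  finally show ?case .
qed simp

text \<open>The antipode of the shuffle algebra reverses words up to sign: in the shuffle product of
  \<open>rev us\<close> and \<open>x # vs\<close>, the words starting with \<open>x\<close> cancel those starting with the last letter of \<open>us\<close>.\<close>

lemma alternal_rev:
  fixes h :: "'a list \<Rightarrow> 'b :: ring_1"
  assumes alt: "\<And>xs ys. xs \<noteq> [] \<Longrightarrow> ys \<noteq> [] \<Longrightarrow> distinct (xs @ ys) \<Longrightarrow> set (xs @ ys) = S \<Longrightarrow>
      sum h (shuffles xs ys) = 0"
    and w: "distinct w" "set w = S" "w \<noteq> []"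
  shows "h (rev w) = (- 1) ^ (length w - 1) * h w"
proof -
  have "(\<Sum>z\<in>shuffles (rev us) vs. h (x # z)) = (- 1) ^ length us * h w"
    if "w = us @ x # vs" for us x vs
    using that
  proof (induction us arbitrary: x vs rule: rev_induct)
    case (snoc a us)
    have "sum h (shuffles (a # rev us) (x # vs)) = 0"
      using snoc.prems w by (intro alt) auto
    moreover have "a \<noteq> x"
      using snoc.prems w by auto
    moreover have "(\<Sum>z\<in>shuffles (rev us) (x # vs). h (a # z)) = (- 1) ^ length us * h w"
      using snoc by simp
    ultimately show ?case
      by (simp add: sum_shuffles_Cons_Cons add_eq_0_iff del: shuffles.simps(3))
  qed simp
  \<comment> \<open>With \<open>vs = []\<close> the only shuffle is \<open>rev us\<close>, so the
    sum is the single term \<open>h (rev w)\<close>.\<close>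
  from this[of "butlast w" "last w" "[]"] show ?thesis
    using w(3) by (cases w rule: rev_cases) simp_all
qed

section \<open>Functions of words that change by a factor under rotation\<close>

lemma rotation_power:
  fixes g :: "'a list \<Rightarrow> 'b :: comm_ring_1"
  assumes rot: "\<And>ys. distinct ys \<Longrightarrow> set ys = S \<Longrightarrow> g (rotate1 ys) = \<epsilon> * g ys"
    and "distinct ys" "set ys = S"
  shows "g (rotate j ys) = \<epsilon> ^ j * g ys"
  by (induction j) (simp_all add: rot assms(2,3) mult.assoc)

text \<open>Inserting \<open>x\<close> into all gaps of a cyclic word amounts to cutting the word in all places and
  putting \<open>x\<close> in front.\<close>

lemma sum_shuffles_singleton_cyclic:
  fixes g :: "'a list \<Rightarrow> 'b :: comm_ring_1"
  assumes rot: "\<And>ys. distinct ys \<Longrightarrow> set ys = S \<Longrightarrow> g (rotate1 ys) = \<epsilon> * g ys"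
    and "\<epsilon> * \<epsilon> = 1"
    and zs: "distinct (x # zs @ [y])" "set (x # zs @ [y]) = S"
  shows "(\<Sum>w\<in>shuffles [x] zs. g (w @ [y])) =
    (\<Sum>j<Suc (length zs). \<epsilon> ^ j * g (x # rotate j (zs @ [y])))"
proof -
  have "g (take j zs @ x # drop j zs @ [y]) = \<epsilon> ^ j * g (x # rotate j (zs @ [y]))"
    if "j < Suc (length zs)" for j
  proof -
    let ?u = "take j zs @ x # drop j zs @ [y]"
    have *: "distinct (take j zs @ drop j zs)" "set (take j zs @ drop j zs) = set zs"
      using zs by simp_all
    have u: "distinct ?u" "set ?u = S"
      using zs * by (auto simp del: append_take_drop_id simp: set_append)
    have "zs @ [y] = take j zs @ drop j zs @ [y]"
      by (simp flip: append_assoc)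
    then have "rotate j (zs @ [y]) = drop j zs @ y # take j zs"
      using that rotate_append[of "take j zs" "drop j zs @ [y]"]
      by (metis append.assoc append_Cons append_Nil length_take less_Suc_eq_le min_absorb2)
    \<comment> \<open>The letter \<open>x\<close> is at position \<open>j\<close> of
      \<open>?u\<close>, so \<open>j\<close> rotations bring it to the front;
      \<open>\<epsilon> ^ j\<close> is its own inverse.\<close>
    then have "rotate j ?u = x # rotate j (zs @ [y])"
      using that rotate_append[of "take j zs" "x # drop j zs @ [y]"] by simp
    then have "g (x # rotate j (zs @ [y])) = \<epsilon> ^ j * g ?u"
      using rotation_power[of S g \<epsilon> ?u j, OF rot u] by simp
    moreover have "\<epsilon> ^ j * \<epsilon> ^ j = 1"
      using assms(2) by (simp flip: power_mult_distrib)
    ultimately show ?thesis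
      by (simp flip: mult.assoc)
  qed
  with zs show ?thesis
    by (simp add: sum_shuffles_singleton del: sum.lessThan_Suc)
qed

text \<open>A full turn settles odd lengths. In even length the insertion relation is combined for
  two consecutive rotations of the tail.\<close>

lemma anticyclic_alternal_eq_0:
  fixes g :: "'a list \<Rightarrow> 'b :: comm_ring_1"
  assumes two: "\<And>a :: 'b. a + a = 0 \<Longrightarrow> a = 0"
    and rot: "\<And>ys. distinct ys \<Longrightarrow> set ys = S \<Longrightarrow> g (rotate1 ys) = - g ys"
    and ins: "\<And>x zs y. distinct (x # zs @ [y]) \<Longrightarrow> set (x # zs @ [y]) = S \<Longrightarrow>
      (\<Sum>w\<in>shuffles [x] zs. g (w @ [y])) = 0"
    and ys: "distinct ys" "set ys = S" "length ys \<ge> 2"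
  shows "g ys = 0"
proof (cases "odd (length ys)")
  case True
  have "g ys = (- 1) ^ length ys * g ys"
    using rotation_power[of S g "- 1" ys "length ys"] rot ys by simp
  with True have "g ys = - g ys"
    by simp
  then have "g ys + g ys = 0"
    by (metis add.right_inverse)
  then show ?thesis
    by (rule two)
next
  case False
  from ys(3) obtain x z where xz: "ys = x # z" "z \<noteq> []"
    by (cases ys; cases "tl ys") auto
  have S: "(\<Sum>j<length z. (- 1) ^ j * g (x # rotate j u)) = 0"
    if u: "distinct (x # u)" "set (x # u) = S" "length u = length z" for u
  proof -
    obtain zs y where zs: "u = zs @ [y]"
      using u xz by (cases u rule: rev_cases) auto
    then show ?thesis
      using sum_shuffles_singleton_cyclic[of S g "- 1" x zs y] rot ins[of x zs y] u
      by (simp del: sum.lessThan_Suc)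
  qed
  \<comment> \<open>The terms for \<open>rotate1 z\<close> are those for \<open>z\<close> shifted by
    one with opposite sign, so the sum telescopes. The tail has odd length, so the end terms add
    up.\<close>
  have "0 = (\<Sum>j<length z. (- 1) ^ j * g (x # rotate j z)) +
      (\<Sum>j<length z. (- 1) ^ j * g (x # rotate j (rotate1 z)))"
    using S[of z] S[of "rotate1 z"] ys xz by simp
  also have "\<dots> = (\<Sum>j<length z. (- 1) ^ j * g (x # rotate j z) - (- 1) ^ Suc j * g (x # rotate (Suc j) z))"
    by (simp add: rotate1_rotate_swap sum.distrib)
  also have "\<dots> = g (x # z) - (- 1) ^ length z * g (x # rotate (length z) z)"
    using sum_lessThan_telescope'[of "\<lambda>j. (- 1) ^ j * g (x # rotate j z)" "length z"] by simp
  also have "\<dots> = g ys + g ys"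
    using False xz by simp
  finally show ?thesis
    using two by metis
qed

text \<open>\<open>\<pi>\<close> matches letters by position. As the identity elsewhere, it permutes
  all indices, so renaming along it is an invertible substitution.\<close>

lemma obtain_bij_map_eq:
  assumes "distinct us" "distinct vs" "set us = set vs"
  obtains \<pi> where "bij \<pi>" "map \<pi> us = vs" "\<And>x. x \<notin> set us \<Longrightarrow> \<pi> x = x"
proof -
  have len: "length us = length vs"
    using assms by (metis distinct_card)
  have us: "bij_betw ((!) us) {..<length us} (set us)" and vs: "bij_betw ((!) vs) {..<length us} (set us)"
    using assms len by (auto intro!: bij_betw_nth)
  define \<pi> where "\<pi> x = (if x \<in> set us then vs ! inv_into {..<length us} ((!) us) x else x)" for x
  have "bij_betw (\<lambda>x. vs ! inv_into {..<length us} ((!) us) x) (set us) (set us)"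
    using bij_betw_trans[OF bij_betw_inv_into[OF us] vs] by (simp add: comp_def)
  then have "bij_betw \<pi> (set us) (set us)"
    by (rule bij_betw_cong[THEN iffD1, rotated]) (simp add: \<pi>_def)
  moreover have "bij_betw \<pi> (- set us) (- set us)"
    by (rule bij_betw_cong[THEN iffD1, OF _ bij_betw_id]) (simp add: \<pi>_def)
  ultimately have "bij \<pi>"
    using bij_betw_combine[of \<pi> "set us" "set us" "- set us" "- set us"] by simp
  moreover have "map \<pi> us = vs"
    using us len by (auto intro!: nth_equalityI simp: \<pi>_def bij_betw_inv_into_left)
  ultimately show thesis
    by (rule that) (simp add: \<pi>_def)
qed

section \<open>Cyclic coordinates\<close>

definition list_subst :: "ratfun list \<Rightarrow> nat \<Rightarrow> ratfun" where
  "list_subst ws i = (if 1 \<le> i \<and> i \<le> length ws then ws ! (i - 1) else var i)"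

lemma mev_eq_subst: "mev B ws = subst (list_subst ws) (B (length ws))"
  by (simp add: mev_def list_subst_def[abs_def])

lemma nondegenerate_perm:
  assumes "bij \<pi>"
  shows "nondegenerate (\<lambda>i. var (\<pi> i))"
proof (rule nondegenerateI)
  show "psubst_rel (\<lambda>i. var (inv \<pi> i)) (var (\<pi> i)) (var i)" for i
    using psubst_rel_var[of "\<lambda>i. var (inv \<pi> i)" "\<pi> i"] assms by (simp add: bij_is_inj)
qed

lemma list_subst_perm:
  assumes "distinct w" "set w = {1..r}"
  obtains \<pi> where "bij \<pi>" "list_subst (map var w) = (\<lambda>i. var (\<pi> i))"
proof -
  have set: "set [1..<r + 1] = {1..r}"
    by (auto simp del: upt_Suc)
  obtain \<pi> where \<pi>: "bij \<pi>" "map \<pi> [1..<r + 1] = w" "\<And>x. x \<notin> {1..r} \<Longrightarrow> \<pi> x = x"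
    using obtain_bij_map_eq[of "[1..<r + 1]" w] assms unfolding set by (metis distinct_upt)
  have "list_subst (map var w) i = var (\<pi> i)" for i
    unfolding \<pi>(2)[symmetric] list_subst_def using \<pi>(3) by (auto simp del: upt_Suc)
  with \<pi>(1) that show thesis
    by blast
qed

lemma nondegenerate_list_subst_perm:
  "distinct w \<Longrightarrow> set w = {1..r} \<Longrightarrow> nondegenerate (list_subst (map var w))"
  by (erule (1) list_subst_perm) (simp add: nondegenerate_perm)

lemma length_perm_1: "distinct w \<Longrightarrow> set w = {1..r :: nat} \<Longrightarrow> length w = r"
  by (metis card_atLeastAtMost diff_Suc_1 distinct_card)

lemma length_perm_0: "distinct w \<Longrightarrow> set w = {0..r :: nat} \<Longrightarrow> length w = Suc r"
  by (metis card_atLeastAtMost diff_zero distinct_card)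

lemma mev_var_id: "mev B (map var [1..<r + 1]) = B r"
proof -
  have "list_subst (map var [1..<r + 1]) = var"
    by (auto simp: list_subst_def fun_eq_iff simp del: upt_Suc)
  then show ?thesis
    by (simp add: mev_eq_subst del: upt_Suc)
qed

lemma subst_perm_mev:
  assumes w: "distinct w" "set w = {1..r}"
    and \<pi>: "bij \<pi>" "\<And>x. x \<notin> {1..r} \<Longrightarrow> \<pi> x = x"
  shows "subst (\<lambda>i. var (\<pi> i)) (mev B (map var w)) = mev B (map var (map \<pi> w))"
proof -
  have "subst (\<lambda>i. var (\<pi> i)) (list_subst (map var w) i) = list_subst (map var (map \<pi> w)) i" for i
    using \<pi> w length_perm_1[OF w] by (auto simp: list_subst_def nondegenerate_perm)
  then show ?thesis
    using w \<pi> by (simp add: mev_eq_subst subst_subst nondegenerate_perm nondegenerate_list_subst_perm[OF w])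
qed

text \<open>\<open>alternal\<close> only treats the standard word cut at
  \<open>i \<le> r div 2\<close>. Renaming variables reaches all other words, and commutativity of
  shuffles covers a longer first word.\<close>

lemma alternal_shuffles:
  assumes B: "alternal B"
    and "xs \<noteq> []" "ys \<noteq> []" "distinct (xs @ ys)" "set (xs @ ys) = {1..r}"
  shows "(\<Sum>w\<in>shuffles xs ys. mev B (map var w)) = 0"
proof -
  have *: "(\<Sum>w\<in>shuffles xs ys. mev B (map var w)) = 0"
    if xy: "xs \<noteq> []" "ys \<noteq> []" "distinct (xs @ ys)" "set (xs @ ys) = {1..r}" "length xs \<le> length ys" for xs ys
  proof -
    define i where "i = length xs"
    have r: "r = length xs + length ys"
      using length_perm_1[OF xy(3,4)] by simp
    have "length xs > 0" "length ys > 0"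
      using xy by simp_all
    then have i: "1 \<le> i" "i \<le> r div 2" "r \<ge> 2"
      unfolding i_def r using xy(5) by linarith+
    have set: "set [1..<r + 1] = {1..r}"
      by (auto simp del: upt_Suc)
    have split: "[1..<r + 1] = [1..<i + 1] @ [i + 1..<r + 1]"
      using i upt_add_eq_append[of 1 "i + 1" "r - i"] by simp
    obtain \<pi> where \<pi>: "bij \<pi>" "map \<pi> [1..<r + 1] = xs @ ys" "\<And>x. x \<notin> {1..r} \<Longrightarrow> \<pi> x = x"
      using obtain_bij_map_eq[of "[1..<r + 1]" "xs @ ys"] xy(3,4) unfolding set by (metis distinct_upt)
    have xs: "map \<pi> [1..<i + 1] = xs" and ys: "map \<pi> [i + 1..<r + 1] = ys"
      using \<pi>(2) unfolding split map_append
      by (auto simp: i_def append_eq_append_conv simp del: upt_Suc)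
    have "inj \<pi>"
      using \<pi>(1) by (rule bij_is_inj)
    have "(\<Sum>w\<in>shuffles xs ys. mev B (map var w)) =
        (\<Sum>w\<in>shuffles [1..<i + 1] [i + 1..<r + 1]. mev B (map var (map \<pi> w)))"
      unfolding xs[symmetric] ys[symmetric] shuffles_map
      by (subst sum.reindex) (auto intro: inj_on_subset[OF inj_mapI[OF \<open>inj \<pi>\<close>]])
    also have "\<dots> = (\<Sum>w\<in>shuffles [1..<i + 1] [i + 1..<r + 1]. subst (\<lambda>i. var (\<pi> i)) (mev B (map var w)))"
    proof (rule sum.cong[OF refl])
      fix w assume "w \<in> shuffles [1..<i + 1] [i + 1..<r + 1]"
      then have "distinct w" "set w = {1..r}"
        using i by (auto dest: distinct_disjoint_shuffles[rotated 3] simp: set_shuffles simp del: upt_Suc)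
      then show "mev B (map var (map \<pi> w)) = subst (\<lambda>i. var (\<pi> i)) (mev B (map var w))"
        using \<pi> by (metis subst_perm_mev)
    qed
    also have "\<dots> = subst (\<lambda>i. var (\<pi> i)) (\<Sum>w\<in>shuffles (map var [1..<i + 1]) (map var [i + 1..<r + 1]). mev B w)"
      using \<pi> unfolding shuffles_map
      by (subst sum.reindex)
        (auto simp: subst_sum nondegenerate_perm inj_on_def map_inj_on inj_map_eq_map simp del: upt_Suc)
    also have "\<dots> = 0"
      using B i by (simp add: alternal_def del: upt_Suc)
    finally show ?thesis .
  qed
  show ?thesis
    using *[of xs ys] *[of ys xs] assms by (cases "length xs \<le> length ys") (auto simp: shuffles_commutes[of xs])
qed

text \<open>The word \<open>ys\<close> lists the indices of \<open>x\<^sub>r, \<dots>, x\<^sub>0\<close>, in the order of the swapped variables.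
  The value at 0 is irrelevant for elements of Q(u1,...,ur) but makes the substitution invertible.\<close>

definition cyc_subst :: "nat \<Rightarrow> nat list \<Rightarrow> nat \<Rightarrow> ratfun" where
  "cyc_subst r ys i =
    (if i = 0 then var (ys ! r) else if i \<le> r then var (ys ! (r - i)) - var (ys ! (Suc r - i)) else var i)"

lemma subst_perm_cyc_subst:
  assumes "bij \<pi>" "\<And>x. x \<notin> {0..r} \<Longrightarrow> \<pi> x = x" "length ys = Suc r"
  shows "subst (\<lambda>i. var (\<pi> i)) (cyc_subst r ys i) = cyc_subst r (map \<pi> ys) i"
  using assms by (auto simp: cyc_subst_def nondegenerate_perm subst_diff)

text \<open>For the word \<open>r, ..., 0\<close>, index \<open>i\<close> goes to
  \<open>x_i - x_(i-1)\<close> and index 0 to \<open>x_0\<close>, which partial sums invert; the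
  other words follow by a permutation.\<close>

lemma nondegenerate_cyc_subst:
  assumes "distinct ys" "set ys = {0..r}"
  shows "nondegenerate (cyc_subst r ys)"
proof -
  define zs where "zs = rev [0..<Suc r]"
  define \<tau> where "\<tau> i = (if i \<le> r then \<Sum>j\<le>i. var j else var i)" for i
  have nth: "zs ! (r - i) = i" if "i \<le> r" for i
    using that by (simp add: zs_def rev_nth del: upt_Suc)
  have zs: "cyc_subst r zs i = (if i = 0 then var 0 else if i \<le> r then var i - var (i - 1) else var i)" for i
  proof (cases i)
    case 0
    then show ?thesis
      using nth[of 0] by (simp add: cyc_subst_def)
  next
    case (Suc j)
    then show ?thesis
      using nth[of j] nth[of i]
      by (simp add: cyc_subst_def)
  qed
  have nd: "nondegenerate (cyc_subst r zs)"
  proof (rule nondegenerateI)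
    show "psubst_rel \<tau> (cyc_subst r zs i) (var i)" for i
    proof (cases "i = 0 \<or> i > r")
      case True
      then show ?thesis
        using psubst_rel_var[of \<tau> i] by (auto simp: zs \<tau>_def)
    next
      case False
      then have "\<tau> i - \<tau> (i - 1) = var i"
        by (cases i) (auto simp: \<tau>_def)
      then show ?thesis
        using psubst_rel_diff[OF psubst_rel_var psubst_rel_var, of \<tau> i "i - 1"] False by (simp add: zs)
    qed
  qed
  have set: "set zs = {0..r}" "distinct zs"
    by (auto simp: zs_def)
  then obtain \<pi> where "bij \<pi>" "map \<pi> zs = ys" "\<And>x. x \<notin> {0..r} \<Longrightarrow> \<pi> x = x"
    using obtain_bij_map_eq[of zs ys] assms by metis
  moreover from this have "(\<lambda>i. subst (\<lambda>i. var (\<pi> i)) (cyc_subst r zs i)) = cyc_subst r ys"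
    using subst_perm_cyc_subst[of \<pi> r zs] length_perm_0[OF set(2,1)] by auto
  ultimately show ?thesis
    using nondegenerate_comp[OF nondegenerate_perm nd, of \<pi>] by simp
qed

section \<open>Negation, translation, swap and push as invertible substitutions\<close>

definition neg_subst :: "nat \<Rightarrow> ratfun" where
  "neg_subst i = - var i"

lemma nondegenerate_neg [simp]: "nondegenerate neg_subst"
proof (rule nondegenerateI)
  show "psubst_rel neg_subst (neg_subst i) (var i)" for i
    using psubst_rel_minus[OF psubst_rel_var, of neg_subst i] by (simp add: neg_subst_def)
qed

lemma subst_neg_neg [simp]: "subst neg_subst (subst neg_subst f) = f"
proof -
  have "(\<lambda>i. subst neg_subst (neg_subst i)) = var"
    by (rule ext) (metis add.inverse_inverse neg_subst_def nondegenerate_neg subst_minus subst_var)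
  then show ?thesis
    by (simp add: subst_subst)
qed

text \<open>Undoes the normalization of the last letter to zero: \<open>v_i\<close> is read as
  \<open>x_i - x_0\<close>.\<close>

definition shift_subst :: "nat \<Rightarrow> nat \<Rightarrow> ratfun" where
  "shift_subst r i = (if 1 \<le> i \<and> i \<le> r then var i - var 0 else var i)"

lemma nondegenerate_shift [simp]: "nondegenerate (shift_subst r)"
proof (rule nondegenerateI)
  define \<tau> where "\<tau> i = (if 1 \<le> i \<and> i \<le> r then var i + var 0 else var i)" for i
  show "psubst_rel \<tau> (shift_subst r i) (var i)" for i
    using psubst_rel_diff[OF psubst_rel_var psubst_rel_var, of \<tau> i 0] psubst_rel_var[of \<tau> i]
    by (auto simp: shift_subst_def \<tau>_def)
qed

definition swap_list :: "nat \<Rightarrow> ratfun list" where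
  "swap_list r = map (\<lambda>k. if k = 0 then var r else var (r - k) - var (r - k + 1)) [0..<r]"

lemma list_subst_swap_list:
  "list_subst (swap_list r) i =
    (if i = 0 \<or> i > r then var i else if i = 1 then var r else var (Suc r - i) - var (Suc (Suc r) - i))"
proof (cases "i = 0 \<or> i > r")
  case False
  then have "r - (i - 1) = Suc r - i" "Suc (Suc r - i) = Suc (Suc r) - i" "i - 1 < r"
    by auto
  with False show ?thesis
    by (auto simp: list_subst_def swap_list_def)
qed (auto simp: list_subst_def swap_list_def)

lemma nondegenerate_swap_list: "nondegenerate (list_subst (swap_list r))"
proof (rule nondegenerateI)
  \<comment> \<open>Solving the swap for its variables: \<open>v_i\<close> is
    \<open>u_1 + ... + u_(r+1-i)\<close>.\<close>
  define \<tau> where "\<tau> i = (if 1 \<le> i \<and> i \<le> r then \<Sum>j=1..Suc r - i. var j else var i)" for i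
  show "psubst_rel \<tau> (list_subst (swap_list r) i) (var i)" for i
  proof (cases "i \<le> 1 \<or> i > r")
    case True
    then show ?thesis
      using psubst_rel_var[of \<tau> i] psubst_rel_var[of \<tau> r]
      by (cases "i = 1") (auto simp: list_subst_swap_list \<tau>_def)
  next
    case False
    then have "\<tau> (Suc r - i) = (\<Sum>j=1..Suc (i - 1). var j)" "\<tau> (Suc (Suc r) - i) = (\<Sum>j=1..i - 1. var j)"
      by (auto simp: \<tau>_def Suc_diff_le intro!: sum.cong)
    then have "\<tau> (Suc r - i) - \<tau> (Suc (Suc r) - i) = var i"
      using False by simp
    then show ?thesis
      using psubst_rel_diff[OF psubst_rel_var psubst_rel_var, of \<tau> "Suc r - i" "Suc (Suc r) - i"] False
      by (simp add: list_subst_swap_list)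
  qed
qed

lemma swap_eq_subst: "swap A r = subst (list_subst (swap_list r)) (A r)"
  by (simp add: swap_def mev_eq_subst swap_list_def)

definition push_list :: "nat \<Rightarrow> ratfun list" where
  "push_list r = (- (\<Sum>i=1..r. var i)) # map var [1..<r]"

lemma list_subst_push_list:
  assumes "r \<ge> 1"
  shows "list_subst (push_list r) i =
    (if i = 0 \<or> i > r then var i else if i = 1 then - (\<Sum>i=1..r. var i) else var (i - 1))"
  using assms by (auto simp: list_subst_def push_list_def nth_Cons')

lemma nondegenerate_push_list:
  assumes "r \<ge> 1"
  shows "nondegenerate (list_subst (push_list r))"
proof (rule nondegenerateI)
  \<comment> \<open>The inverse of push shifts \<open>u_0, ..., u_r\<close> cyclically the other
    way, so \<open>u_r\<close> goes to \<open>u_0\<close>, the negated sum.\<close>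
  define \<tau> where
    "\<tau> i = (if i = 0 \<or> i > r then var i else if i < r then var (Suc i) else - (\<Sum>i=1..r. var i))" for i
  obtain n where n: "r = Suc n"
    using assms by (cases r) auto
  have "(\<Sum>i=1..r. \<tau> i) = (\<Sum>i=1..n. var (Suc i)) - (\<Sum>i=1..r. var i)"
    by (simp add: n \<tau>_def)
  also have "(\<Sum>i=1..r. var i) = var 1 + (\<Sum>i=1..n. var (Suc i))"
    using sum.atLeast_Suc_atMost[of 1 r var] sum.shift_bounds_cl_Suc_ivl[of var 1 n] by (simp add: n del: sum.cl_ivl_Suc)
  finally have "- (\<Sum>i=1..r. \<tau> i) = var 1"
    by simp
  then have *: "psubst_rel \<tau> (- (\<Sum>i=1..r. var i)) (var 1)"
    using psubst_rel_minus[OF psubst_rel_sum[of "{1..r}" \<tau> var \<tau>, OF psubst_rel_var]] by simp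
  show "psubst_rel \<tau> (list_subst (push_list r) i) (var i)" for i
  proof (cases "i \<le> 1 \<or> i > r")
    case True
    then show ?thesis
      using * psubst_rel_var[of \<tau> i] assms
      by (cases "i = 1") (auto simp: list_subst_push_list \<tau>_def)
  next
    case False
    then have "\<tau> (i - 1) = var i"
      by (auto simp: \<tau>_def)
    then show ?thesis
      using psubst_rel_var[of \<tau> "i - 1"] assms False by (simp add: list_subst_push_list)
  qed
qed

lemma subst_sign:
  "nondegenerate \<sigma> \<Longrightarrow> subst \<sigma> ((- 1) ^ k * f) = (- 1) ^ k * subst \<sigma> f"
  by (cases "even k") (simp_all add: subst_minus)

lemma ratfun_double_eq_0: "a + a = 0 \<Longrightarrow> (a :: ratfun) = 0"
proof -
  assume "a + a = 0"
  then have "const (1 + 1) * a = 0"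
    by (simp only: const_add const_1 distrib_right mult_1)
  moreover have "const (1 + 1) \<noteq> 0"
    by (simp add: const_def Fract_eq_0_iff)
  ultimately show "a = 0"
    by simp
qed

text \<open>The function \<open>G\<close> of the overview; for \<open>A r\<close> in
  \<open>u_1, ..., u_r\<close> only differences of letters enter.\<close>

definition cyc_eval :: "mould \<Rightarrow> nat \<Rightarrow> nat list \<Rightarrow> ratfun" where
  "cyc_eval A r ys = subst (cyc_subst r ys) (A r)"

lemma subst_perm_cyc_eval:
  assumes "bij \<pi>" "\<And>x. x \<notin> {0..r} \<Longrightarrow> \<pi> x = x" "distinct ys" "set ys = {0..r}"
  shows "subst (\<lambda>i. var (\<pi> i)) (cyc_eval A r ys) = cyc_eval A r (map \<pi> ys)"
proof -
  have "(\<lambda>i. subst (\<lambda>i. var (\<pi> i)) (cyc_subst r ys i)) = cyc_subst r (map \<pi> ys)"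
    using subst_perm_cyc_subst[of \<pi> r ys] assms length_perm_0 by blast
  then show ?thesis
    using assms by (simp add: cyc_eval_def subst_subst nondegenerate_perm nondegenerate_cyc_subst)
qed

text \<open>Reversing the arguments of \<open>A\<close> costs the sign from
  \<open>alternal_rev\<close>; the differences of \<open>ys\<close> read backwards are the negated
  differences of \<open>rev ys\<close>.\<close>

lemma cyc_eval_rev:
  assumes A: "in_Qr r (A r)" "alternal A" and "r \<ge> 1" and ys: "distinct ys" "set ys = {0..r}"
  shows "cyc_eval A r ys = (- 1) ^ (r - 1) * subst neg_subst (cyc_eval A r (rev ys))"
proof -
  let ?w = "[1..<r + 1]"
  have w: "distinct ?w" "set ?w = {1..r}" "?w \<noteq> []" "length ?w = r"
    using \<open>r \<ge> 1\<close> by (auto simp del: upt_Suc)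
  have len: "length ys = Suc r"
    using length_perm_0[OF ys] .
  have nd: "nondegenerate (cyc_subst r ys)" "nondegenerate (cyc_subst r (rev ys))"
    using ys by (auto intro: nondegenerate_cyc_subst)
  have ndr: "nondegenerate (list_subst (map var (rev ?w)))"
    using w by (intro nondegenerate_list_subst_perm) auto
  have "mev A (map var (rev ?w)) = (- 1) ^ (length ?w - 1) * mev A (map var ?w)"
    by (rule alternal_rev[where S = "{1..r}" and h = "\<lambda>w. mev A (map var w)"])
      (use alternal_shuffles[OF A(2)] w in auto)
  then have "A r = (- 1) ^ (r - 1) * mev A (map var (rev ?w))"
    unfolding mev_var_id w(4) by (simp flip: mult.assoc power_mult_distrib)
  then have "cyc_eval A r ys = (- 1) ^ (r - 1) * subst (cyc_subst r ys) (mev A (map var (rev ?w)))"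
    unfolding cyc_eval_def using nd by (metis subst_sign)
  also have "subst (cyc_subst r ys) (mev A (map var (rev ?w))) =
      subst (\<lambda>i. subst (cyc_subst r ys) (list_subst (map var (rev ?w)) i)) (A r)"
    using subst_subst[OF nd(1) ndr] w(4) by (simp add: mev_eq_subst del: upt_Suc)
  also have "\<dots> = subst (\<lambda>i. subst neg_subst (cyc_subst r (rev ys) i)) (A r)"
  proof (rule subst_cong_in_Qr[OF A(1)])
    fix i assume i: "1 \<le> i" "i \<le> r"
    then have "list_subst (map var (rev ?w)) i = var (Suc r - i)"
      by (auto simp: list_subst_def rev_nth simp del: upt_Suc)
    moreover have "rev ys ! (r - i) = ys ! i" "rev ys ! (Suc r - i) = ys ! (i - 1)"
      using i len by (auto simp: rev_nth)
    moreover have "r - (Suc r - i) = i - 1" "Suc r - (Suc r - i) = i" "Suc r - i \<le> r"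
      using i by auto
    ultimately show "subst (cyc_subst r ys) (list_subst (map var (rev ?w)) i) =
        subst neg_subst (cyc_subst r (rev ys) i)"
      using i nd by (simp add: cyc_subst_def[of r] subst_diff neg_subst_def)
  qed (use nd ndr in \<open>auto intro: nondegenerate_comp\<close>)
  also have "\<dots> = subst neg_subst (cyc_eval A r (rev ys))"
    using nd by (simp add: cyc_eval_def subst_subst)
  finally show ?thesis .
qed

text \<open>The shift cancels in all swapped arguments but the first, which becomes the last letter
  of \<open>w\<close> minus \<open>x_0\<close>: these are the differences of
  \<open>w @ [0]\<close>.\<close>

lemma subst_shift_mev_swap:
  assumes A: "in_Qr r (A r)" and w: "distinct w" "set w = {1..r}"
  shows "subst (shift_subst r) (mev (swap A) (map var w)) = cyc_eval A r (w @ [0])"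
proof -
  let ?\<sigma> = "list_subst (map var w)" and ?\<tau> = "list_subst (swap_list r)"
  have len: "length w = r"
    using length_perm_1[OF w] .
  have nd: "nondegenerate ?\<sigma>" "nondegenerate (cyc_subst r (w @ [0]))"
    using nondegenerate_list_subst_perm[OF w] nondegenerate_cyc_subst[of "w @ [0]" r] w
    by (auto simp: atLeastAtMost_insertL[of 0 r, simplified])
  have w_nth: "1 \<le> w ! k \<and> w ! k \<le> r" if "k < r" for k
    using that w(2) len by (metis atLeastAtMost_iff nth_mem)
  have "subst (shift_subst r) (mev (swap A) (map var w)) =
      subst (\<lambda>i. subst (shift_subst r) (subst ?\<sigma> (?\<tau> i))) (A r)"
    using nd nondegenerate_swap_list
    by (simp add: mev_eq_subst len swap_eq_subst subst_subst nondegenerate_comp)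
  also have "\<dots> = subst (cyc_subst r (w @ [0])) (A r)"
  proof (rule subst_cong_in_Qr[OF A])
    fix i assume i: "1 \<le> i" "i \<le> r"
    show "subst (shift_subst r) (subst ?\<sigma> (?\<tau> i)) = cyc_subst r (w @ [0]) i"
    proof (cases "i = 1")
      case True
      with i nd len w_nth[of "r - 1"] show ?thesis
        by (simp add: list_subst_swap_list list_subst_def[of "map var w"] cyc_subst_def shift_subst_def nth_append)
    next
      case False
      then have "Suc r - i - 1 = r - i" "Suc (Suc r) - i - 1 = Suc r - i" "r - i < r" "Suc r - i < r"
        "1 \<le> Suc r - i" "1 \<le> Suc (Suc r) - i" "Suc (Suc r) - i \<le> r"
        using i by auto
      with False i nd len w_nth[of "r - i"] w_nth[of "Suc r - i"] show ?thesis
        by (simp add: list_subst_swap_list list_subst_def[of "map var w"] cyc_subst_def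
            shift_subst_def nth_append subst_diff)
    qed
  qed (use nd nondegenerate_swap_list in \<open>auto intro!: nondegenerate_comp\<close>)
  finally show ?thesis
    by (simp add: cyc_eval_def)
qed

text \<open>The differences around a closed cycle sum to zero, so \<open>u_0\<close> is the last
  letter minus the first, the difference that rotation brings in.\<close>

lemma subst_cyc_mev_push:
  assumes A: "in_Qr r (A r)" and "r \<ge> 1" and ys: "distinct ys" "set ys = {0..r}"
  shows "subst (cyc_subst r ys) (mev A (push_list r)) = cyc_eval A r (rotate1 ys)"
proof -
  let ?\<tau> = "list_subst (push_list r)"
  have len: "length ys = Suc r"
    using length_perm_0[OF ys] .
  have nd: "nondegenerate (cyc_subst r ys)" "nondegenerate (cyc_subst r (rotate1 ys))"
    using ys by (simp_all add: nondegenerate_cyc_subst)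
  have "subst (cyc_subst r ys) (mev A (push_list r)) = subst (\<lambda>i. subst (cyc_subst r ys) (?\<tau> i)) (A r)"
  proof -
    have "length (push_list r) = r"
      using \<open>r \<ge> 1\<close> by (simp add: push_list_def)
    then show ?thesis
      using nd nondegenerate_push_list[OF \<open>r \<ge> 1\<close>] by (simp add: mev_eq_subst subst_subst)
  qed
  also have "\<dots> = subst (cyc_subst r (rotate1 ys)) (A r)"
  proof (rule subst_cong_in_Qr[OF A])
    fix i assume i: "1 \<le> i" "i \<le> r"
    have nth: "rotate1 ys ! j = ys ! (Suc j mod Suc r)" if "j \<le> r" for j
      using that len by (simp add: nth_rotate1)
    show "subst (cyc_subst r ys) (?\<tau> i) = cyc_subst r (rotate1 ys) i"
    proof (cases "i = 1")
      case True
      have "(\<Sum>j=1..k. cyc_subst r ys j) = var (ys ! (r - k)) - var (ys ! r)" if "k \<le> r" for k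
        using that by (induction k) (auto simp: cyc_subst_def)
      then have "(\<Sum>j=1..r. cyc_subst r ys j) = var (ys ! 0) - var (ys ! r)"
        by simp
      with True i nd \<open>r \<ge> 1\<close> show ?thesis
        by (simp add: list_subst_push_list subst_minus subst_sum cyc_subst_def[of r "rotate1 ys"] nth)
    next
      case False
      \<comment> \<open>Writing \<open>i\<close> and \<open>r\<close> as sums avoids truncated
        subtraction in the indices.\<close>
      then obtain j d where "i = Suc (Suc j)" "r = Suc (Suc j) + d"
        using i by (metis One_nat_def Suc_le_D le_Suc_ex le_antisym not_less_eq_eq)
      with nd \<open>r \<ge> 1\<close> show ?thesis
        by (simp add: list_subst_push_list cyc_subst_def nth)
    qed
  qed (use nd nondegenerate_push_list \<open>r \<ge> 1\<close> in \<open>auto intro!: nondegenerate_comp\<close>)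
  finally show ?thesis
    by (simp add: cyc_eval_def)
qed

text \<open>As \<open>cyc_subst\<close> acts injectively on fractions, a single word decides
  push-invariance in depth \<open>r\<close>.\<close>

lemma mev_push_eq_iff:
  assumes "in_Qr r (A r)" "r \<ge> 1" "distinct ys" "set ys = {0..r}"
  shows "mev A (push_list r) = mev A (map var [1..<r + 1]) \<longleftrightarrow>
    cyc_eval A r (rotate1 ys) = cyc_eval A r ys"
  using subst_cyc_mev_push[of r A, OF assms] subst_eq_iff[OF nondegenerate_cyc_subst[OF assms(3,4)]]
  unfolding mev_var_id by (metis cyc_eval_def)

text \<open>The swap corresponds to words ending in \<open>0\<close>; a permutation of
  \<open>0, ..., r\<close> puts any letter \<open>y\<close> there.\<close>

lemma alternal_swap_cyc_eval:
  assumes A: "in_Qr r (A r)" "alternal (swap A)"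
    and xy: "xs \<noteq> []" "ys \<noteq> []" "distinct ((xs @ ys) @ [y])" "set ((xs @ ys) @ [y]) = {0..r}"
  shows "(\<Sum>w\<in>shuffles xs ys. cyc_eval A r (w @ [y])) = 0"
proof -
  define i where "i = length xs"
  have r: "r = length xs + length ys"
    using length_perm_0[OF xy(3,4)] by simp
  have i: "1 \<le> i" "i < r"
    using xy by (auto simp: i_def r Suc_le_eq)
  let ?xs = "[1..<i + 1]" and ?ys = "[i + 1..<r + 1]"
  have 1: "?xs @ ?ys = [1..<r + 1]"
    using i upt_add_eq_append[of 1 "i + 1" "r - i"] by simp
  have 2: "distinct ((?xs @ ?ys) @ [0])" "set ((?xs @ ?ys) @ [0]) = {0..r}"
    unfolding 1 by (auto simp del: upt_Suc)
  obtain \<pi> where \<pi>: "bij \<pi>" "map \<pi> ((?xs @ ?ys) @ [0]) = (xs @ ys) @ [y]" "\<And>x. x \<notin> {0..r} \<Longrightarrow> \<pi> x = x"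
    using obtain_bij_map_eq[OF 2(1) xy(3)] unfolding 2(2) xy(4) by metis
  have xs: "map \<pi> ?xs = xs" and ys: "map \<pi> ?ys = ys" and y: "\<pi> 0 = y"
    using \<pi>(2) by (auto simp: i_def append_eq_append_conv simp del: upt_Suc)
  have "inj \<pi>"
    using \<pi>(1) by (rule bij_is_inj)
  have "(\<Sum>w\<in>shuffles xs ys. cyc_eval A r (w @ [y])) =
      (\<Sum>w\<in>shuffles ?xs ?ys. cyc_eval A r (map \<pi> (w @ [0])))"
    unfolding xs[symmetric] ys[symmetric] shuffles_map
    by (subst sum.reindex) (auto simp: y intro: inj_on_subset[OF inj_mapI[OF \<open>inj \<pi>\<close>]])
  also have "\<dots> = (\<Sum>w\<in>shuffles ?xs ?ys.
      subst (\<lambda>i. var (\<pi> i)) (subst (shift_subst r) (mev (swap A) (map var w))))"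
  proof (rule sum.cong[OF refl])
    fix w assume "w \<in> shuffles ?xs ?ys"
    then have w: "distinct w" "set w = {1..r}"
      using i by (auto dest: distinct_disjoint_shuffles[rotated 3] simp: set_shuffles simp del: upt_Suc)
    then have "distinct (w @ [0])" "set (w @ [0]) = {0..r}"
      by auto
    then show "cyc_eval A r (map \<pi> (w @ [0])) =
        subst (\<lambda>i. var (\<pi> i)) (subst (shift_subst r) (mev (swap A) (map var w)))"
      using subst_perm_cyc_eval[OF \<pi>(1,3)] subst_shift_mev_swap[of r A, OF A(1) w] by simp
  qed
  also have "\<dots> = subst (\<lambda>i. var (\<pi> i)) (subst (shift_subst r)
      (\<Sum>w\<in>shuffles ?xs ?ys. mev (swap A) (map var w)))"
    using \<pi>(1) by (simp add: subst_sum nondegenerate_perm)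
  also have "(\<Sum>w\<in>shuffles ?xs ?ys. mev (swap A) (map var w)) = 0"
    using i 2 by (intro alternal_shuffles[OF A(2), of _ _ r]) (auto simp del: upt_Suc)
  finally show ?thesis
    by simp
qed

section \<open>Push-invariance and circ-neutrality\<close>

text \<open>Alternality of the swap reverses \<open>w\<close> before the fixed \<open>y\<close>;
  \<open>cyc_eval_rev\<close> then reverses the whole word. The signs cancel and one negation
  remains.\<close>

lemma cyc_eval_rotate1_al_al:
  assumes A: "in_Qr r (A r)" "alternal A" "alternal (swap A)" and "r \<ge> 1"
    and ys: "distinct ys" "set ys = {0..r}"
  shows "cyc_eval A r (rotate1 ys) = subst neg_subst (cyc_eval A r ys)"
proof -
  obtain y w where yw: "ys = y # w"
    using ys by (cases ys) auto
  have len: "length w = r"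
    using length_perm_0[OF ys] by (simp add: yw)
  have *: "cyc_eval A r (rev w @ [y]) = (- 1) ^ (length w - 1) * cyc_eval A r (w @ [y])"
  proof (rule alternal_rev[where S = "set w" and h = "\<lambda>w. cyc_eval A r (w @ [y])"])
    fix us vs :: "nat list"
    assume "us \<noteq> []" "vs \<noteq> []" "distinct (us @ vs)" "set (us @ vs) = set w"
    then show "(\<Sum>w\<in>shuffles us vs. cyc_eval A r (w @ [y])) = 0"
      using ys yw by (intro alternal_swap_cyc_eval[of r A, OF A(1,3)]) auto
  qed (use ys yw len \<open>r \<ge> 1\<close> in auto)
  have "cyc_eval A r (rev w @ [y]) = (- 1) ^ (r - 1) * subst neg_subst (cyc_eval A r (y # w))"
    using cyc_eval_rev[of r A "rev w @ [y]"] A ys \<open>r \<ge> 1\<close> yw by simp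
  with * show ?thesis
    by (simp add: len yw)
qed

text \<open>Twice the odd part, \<open>g\<close>, changes sign under rotation and inherits the
  insertion relations because negating the variables is additive.\<close>

lemma cyc_eval_even_al_al:
  assumes A: "in_Qr r (A r)" "alternal A" "alternal (swap A)" and "r \<ge> 2"
    and ys: "distinct ys" "set ys = {0..r}"
  shows "subst neg_subst (cyc_eval A r ys) = cyc_eval A r ys"
proof -
  define g where "g ys = cyc_eval A r ys - subst neg_subst (cyc_eval A r ys)" for ys
  have "g ys = 0"
  proof (rule anticyclic_alternal_eq_0[where S = "{0..r}" and g = g])
    show "g (rotate1 ys) = - g ys" if "distinct ys" "set ys = {0..r}" for ys
      using cyc_eval_rotate1_al_al[of r A ys] A that \<open>r \<ge> 2\<close> by (simp add: g_def)
    show "(\<Sum>w\<in>shuffles [x] zs. g (w @ [y])) = 0"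
      if "distinct (x # zs @ [y])" "set (x # zs @ [y]) = {0..r}" for x zs y
    proof -
      \<comment> \<open>Since \<open>r \<ge> 2\<close>, a letter besides \<open>x\<close> and
        \<open>y\<close> remains, so the insertion is a genuine shuffle relation.\<close>
      have "zs \<noteq> []"
        using length_perm_0[OF that] \<open>r \<ge> 2\<close> by auto
      then have "(\<Sum>w\<in>shuffles [x] zs. cyc_eval A r (w @ [y])) = 0"
        using that by (intro alternal_swap_cyc_eval[of r A, OF A(1,3)]) auto
      then show ?thesis
        by (simp add: g_def sum_subtractf flip: subst_sum)
    qed
    show "2 \<le> length ys"
      using length_perm_0[OF ys] \<open>r \<ge> 2\<close> by simp
  qed (fact ratfun_double_eq_0 ys)+
  then show ?thesis
    by (simp add: g_def)
qed

lemma cyc_eval_push_al_al: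
  assumes "in_Qr r (A r)" "alternal A" "alternal (swap A)" "r \<ge> 2" "distinct ys" "set ys = {0..r}"
  shows "cyc_eval A r (rotate1 ys) = cyc_eval A r ys"
  using cyc_eval_rotate1_al_al[of r A ys] cyc_eval_even_al_al[of r A ys] assms by simp

section \<open>Circ-neutrality and the insertion of one letter\<close>

lemma push_invariant_iff:
  "push_invariant A \<longleftrightarrow> (\<forall>r\<ge>1. mev A (push_list r) = mev A (map var [1..<r + 1]))"
  by (simp add: push_invariant_def push_list_def)

text \<open>The injective shift turns each summand into a word ending in \<open>0\<close>, which
  rotation invariance moves to the front.\<close>

lemma circ_sum_eq_0_iff:
  assumes A: "in_Qr r (A r)"
    and push: "\<And>ys. distinct ys \<Longrightarrow> set ys = {0..r} \<Longrightarrow> cyc_eval A r (rotate1 ys) = cyc_eval A r ys"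
  shows "(\<Sum>i<r. mev (swap A) (rotate i (map var [1..<r + 1]))) = 0 \<longleftrightarrow>
    (\<Sum>i<r. cyc_eval A r (0 # rotate i [1..<r + 1])) = 0"
proof -
  let ?w = "[1..<r + 1]"
  have w: "distinct ?w" "set ?w = {1..r}"
    by (auto simp del: upt_Suc)
  have "subst (shift_subst r) (mev (swap A) (rotate i (map var ?w))) = cyc_eval A r (0 # rotate i ?w)" for i
  proof -
    have "subst (shift_subst r) (mev (swap A) (rotate i (map var ?w))) = cyc_eval A r (rotate i ?w @ [0])"
      unfolding rotate_map using w by (intro subst_shift_mev_swap[of r A, OF A]) (simp_all only: distinct_rotate set_rotate)
    also have "\<dots> = cyc_eval A r (rotate1 (0 # rotate i ?w))"
      by simp
    also have "\<dots> = cyc_eval A r (0 # rotate i ?w)"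
      using w by (intro push) (auto simp del: upt_Suc)
    finally show ?thesis .
  qed
  then have "subst (shift_subst r) (\<Sum>i<r. mev (swap A) (rotate i (map var ?w))) =
      (\<Sum>i<r. cyc_eval A r (0 # rotate i ?w))"
    by (simp add: subst_sum del: upt_Suc)
  then show ?thesis
    using subst_eq_0_iff[OF nondegenerate_shift[of r]] by metis
qed

text \<open>For push-invariant moulds, circ-neutrality of the swap in a given depth is equivalent to its
  first alternality relation.\<close>

lemma insertion_sum_eq_0_iff_circ_sum:
  assumes "in_Qr r (A r)"
    and push: "\<And>ys. distinct ys \<Longrightarrow> set ys = {0..r} \<Longrightarrow> cyc_eval A r (rotate1 ys) = cyc_eval A r ys"
    and zs: "distinct (x # zs @ [y])" "set (x # zs @ [y]) = {0..r}"
  shows "(\<Sum>w\<in>shuffles [x] zs. cyc_eval A r (w @ [y])) = 0 \<longleftrightarrow>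
    (\<Sum>i<r. mev (swap A) (rotate i (map var [1..<r + 1]))) = 0"
proof -
  let ?w = "[1..<r + 1]"
  have w: "distinct (0 # ?w)" "set (0 # ?w) = {0..r}"
    by (auto simp del: upt_Suc)
  \<comment> \<open>Renaming is injective on fractions, so the vanishing can be tested on the
    standard word \<open>0, ..., r\<close>.\<close>
  obtain \<pi> where \<pi>: "bij \<pi>" "map \<pi> (0 # ?w) = x # zs @ [y]" "\<And>x. x \<notin> {0..r} \<Longrightarrow> \<pi> x = x"
    using obtain_bij_map_eq[OF w(1) zs(1)] unfolding w(2) zs(2) by metis
  have len: "Suc (length zs) = r"
    using length_perm_0[OF zs] by simp
  have "(\<Sum>w\<in>shuffles [x] zs. cyc_eval A r (w @ [y])) = (\<Sum>j<r. cyc_eval A r (x # rotate j (zs @ [y])))"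
    using sum_shuffles_singleton_cyclic[of "{0..r}" "cyc_eval A r" 1 x zs y] push zs len by simp
  also have "\<dots> = (\<Sum>j<r. subst (\<lambda>i. var (\<pi> i)) (cyc_eval A r (0 # rotate j ?w)))"
  proof (rule sum.cong[OF refl])
    fix j
    have "map \<pi> (0 # rotate j ?w) = x # rotate j (zs @ [y])"
      using \<pi>(2) by (simp add: rotate_map[symmetric] del: upt_Suc)
    moreover have "distinct (0 # rotate j ?w)" "set (0 # rotate j ?w) = {0..r}"
      using w by simp_all
    ultimately show "cyc_eval A r (x # rotate j (zs @ [y])) = subst (\<lambda>i. var (\<pi> i)) (cyc_eval A r (0 # rotate j ?w))"
      using subst_perm_cyc_eval[OF \<pi>(1,3)] by metis
  qed
  also have "\<dots> = subst (\<lambda>i. var (\<pi> i)) (\<Sum>j<r. cyc_eval A r (0 # rotate j ?w))"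
    using \<pi>(1) by (simp add: subst_sum nondegenerate_perm)
  finally show ?thesis
    using circ_sum_eq_0_iff[of r A, OF assms(1,2)] subst_eq_0_iff[OF nondegenerate_perm[OF \<pi>(1)]] by metis
qed

section \<open>The inclusion, and its converse in depths up to three\<close>

lemma al_al_subset: "ARI_al_al \<subseteq> ARI_al_push_circneut"
proof
  fix A assume "A \<in> ARI_al_al"
  then have A: "is_mould A" "alternal A" "alternal (swap A)" "mev A [- var 1] = mev A [var 1]"
    by (auto simp: ARI_al_al_def)
  have Qr: "in_Qr r (A r)" for r
    using A(1) by (simp add: is_mould_def)
  have "mev A (push_list r) = mev A (map var [1..<r + 1])" if "r \<ge> 1" for r
  \<comment> \<open>In depth 1 push negates \<open>u_1\<close>, so the parity condition of
    \<open>ARI_al_al\<close> is exactly push-invariance there.\<close>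
  proof (cases "r = 1")
    case True
    then show ?thesis
      using A(4) by (simp add: push_list_def)
  next
    case False
    have ys: "distinct [0..<Suc r]" "set [0..<Suc r] = {0..r}"
      by (auto simp del: upt_Suc)
    with False that show ?thesis
      using cyc_eval_push_al_al[of r A, OF Qr A(2,3) _ ys] mev_push_eq_iff[of r A, OF Qr that ys] by simp
  qed
  then have "push_invariant A"
    by (simp add: push_invariant_iff)
  moreover have "circ_neutral (swap A)"
    unfolding circ_neutral_def
  proof (intro allI impI)
    fix r :: nat assume r: "r > 1"
    \<comment> \<open>\<open>r > 1\<close> makes \<open>[1..<r]\<close> nonempty, so inserting
      \<open>0\<close> into it is an alternality relation of the swap.\<close>
    have zs: "distinct (0 # [1..<r] @ [r])" "set (0 # [1..<r] @ [r]) = {0..r}" "[1..<r] \<noteq> []"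
      using r by auto
    then have "(\<Sum>w\<in>shuffles [0] [1..<r]. cyc_eval A r (w @ [r])) = 0"
      by (intro alternal_swap_cyc_eval[of r A, OF Qr A(3)]) auto
    then show "(\<Sum>i<r. mev (swap A) (rotate i (map var [1..<r + 1]))) = 0"
      using insertion_sum_eq_0_iff_circ_sum[of r A 0 "[1..<r]" r] cyc_eval_push_al_al[of r A, OF Qr A(2,3)] Qr zs(1,2) r
      by simp
  qed
  ultimately show "A \<in> ARI_al_push_circneut"
    using A by (simp add: ARI_al_push_circneut_def)
qed

lemma mev_0: "A (length ws) = 0 \<Longrightarrow> mev A ws = 0"
  by (simp add: mev_eq_subst)

text \<open>In depths 2 and 3 only the split \<open>i = 1\<close> occurs, the insertion of one
  letter, which amounts to circ-neutrality. Outside depth \<open>r\<close> the swap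
  vanishes.\<close>

lemma alternal_swap_depth_le_3:
  assumes A: "is_mould A" "push_invariant A" "circ_neutral (swap A)"
    and r: "r \<le> 3" "\<And>s. s \<noteq> r \<Longrightarrow> A s = 0"
  shows "alternal (swap A)"
  unfolding alternal_def
proof (intro allI impI)
  fix s i :: nat
  assume s: "s \<ge> 2" and i: "1 \<le> i \<and> i \<le> s div 2"
  let ?L = "map var [1..<i + 1]" and ?R = "map var [i + 1..<s + 1]"
  show "(\<Sum>w\<in>shuffles ?L ?R. mev (swap A) w) = 0"
  proof (cases "s = r")
    case False
    have "length w = s" if "w \<in> shuffles ?L ?R" for w
      using length_shuffles[OF that] i by auto
    moreover have "swap A s = 0"
      using r(2) False by (simp add: swap_eq_subst)
    ultimately show ?thesis
      by (simp add: mev_0)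
  next
    case True
    then have "i = 1"
      using i r(1) by auto
    have Qr: "in_Qr s (A s)"
      using A(1) by (simp add: is_mould_def)
    have push: "cyc_eval A s (rotate1 ys) = cyc_eval A s ys" if "distinct ys" "set ys = {0..s}" for ys
      using mev_push_eq_iff[of s A, OF Qr _ that] A(2) s by (simp add: push_invariant_iff del: upt_Suc)
    have "(\<Sum>i<s. mev (swap A) (rotate i (map var [1..<s + 1]))) = 0"
      using A(3) s by (simp add: circ_neutral_def del: upt_Suc)
    \<comment> \<open>\<open>0\<close> stands last to match the swap, and \<open>1\<close> is the
      letter shuffled into \<open>2, ..., s\<close>.\<close>
    moreover have zs: "distinct (1 # [2..<s + 1] @ [0])" "set (1 # [2..<s + 1] @ [0]) = {0..s}"
      using s by (auto simp del: upt_Suc)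
    moreover have "(\<Sum>w\<in>shuffles [1] [2..<s + 1]. cyc_eval A s (w @ [0])) = 0 \<longleftrightarrow>
        (\<Sum>i<s. mev (swap A) (rotate i (map var [1..<s + 1]))) = 0"
      by (rule insertion_sum_eq_0_iff_circ_sum[of s A, OF Qr push zs])
    ultimately have "(\<Sum>w\<in>shuffles [1] [2..<s + 1]. cyc_eval A s (w @ [0])) = 0"
      by blast
    moreover have "cyc_eval A s (w @ [0]) = subst (shift_subst s) (mev (swap A) (map var w))"
      if "w \<in> shuffles [1] [2..<s + 1]" for w
    proof -
      have "distinct w"
        by (rule distinct_disjoint_shuffles[OF _ _ _ that]) (auto simp del: upt_Suc)
      moreover have "set w = {1..s}"
        unfolding set_shuffles[OF that] using s by (auto simp del: upt_Suc)
      ultimately show ?thesis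
        by (rule subst_shift_mev_swap[of s A, OF Qr, symmetric])
    qed
    ultimately have "(\<Sum>w\<in>shuffles [1] [2..<s + 1]. mev (swap A) (map var w)) = 0"
      by (simp add: subst_eq_0_iff del: upt_Suc flip: subst_sum)
    moreover have "shuffles ?L ?R = map var ` shuffles [1] [2..<s + 1]"
      unfolding shuffles_map \<open>i = 1\<close> by (simp add: numeral_2_eq_2)
    moreover have "inj_on (map var) (shuffles [1] [2..<s + 1])"
      by (auto simp: inj_on_def inj_map_eq_map)
    ultimately show ?thesis
      by (simp add: sum.reindex del: upt_Suc)
  qed
qed

theorem theorem14:
  shows "ARI_al_al \<subseteq> ARI_al_push_circneut \<and>
    (\<forall>r\<in>{1,2,3}. ARI_depth r \<inter> ARI_al_al = ARI_depth r \<inter> ARI_al_push_circneut)"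
proof (intro conjI ballI)
  show "ARI_al_al \<subseteq> ARI_al_push_circneut"
    by (rule al_al_subset)
  fix r :: nat assume "r \<in> {1, 2, 3}"
  then have r: "r \<le> 3"
    by auto
  have "A \<in> ARI_al_al" if "A \<in> ARI_depth r" "A \<in> ARI_al_push_circneut" for A
  proof -
    have A: "is_mould A" "alternal A" "push_invariant A" "circ_neutral (swap A)" "\<And>s. s \<noteq> r \<Longrightarrow> A s = 0"
      using that by (auto simp: ARI_depth_def ARI_al_push_circneut_def)
    \<comment> \<open>Whatever \<open>r\<close> is, push-invariance in depth 1 yields the parity
      condition.\<close>
    then have "mev A (push_list 1) = mev A (map var [1..<1 + 1])"
      unfolding push_invariant_iff by blast
    then have "mev A [- var 1] = mev A [var 1]"
      by (simp add: push_list_def)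
    with A alternal_swap_depth_le_3[OF A(1,3,4) r] show ?thesis
      by (simp add: ARI_al_al_def)
  qed
  with al_al_subset show "ARI_depth r \<inter> ARI_al_al = ARI_depth r \<inter> ARI_al_push_circneut"
    by blast
qed

end
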